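(* Let $R=K[x_1,\dots,x_n]$ with $K$ a field of characteristic zero, let $\succ$ be a fixed admissible monomial ordering, and let $L$ be a constructive involutive division. A monic minimal $L$-involutive basis of a polynomial ideal is unique: if $G_1,G_2\subset R$ are two finite minimal $L$-involutive bases of the same ideal, $Id(G_1)=Id(G_2)$, and all elements of $G_1$ and of $G_2$ are monic, then $G_1=G_2$.
   Context: $\mathbb{M}$ is the set of monomials in $x_1,\dots,x_n$; $u\mid v$ is ordinary divisibility. $Id(F)$ is the ideal of $R$ generated by $F$; $lm(f)$ and $lc(f)$ are the leading monomial and leading coefficient of $f$ with respect to $\succ$; $lm(F)=\{lm(f)\mid f\in F\}$. The paper assumes throughout $x_1\succ x_2\succ\dots\succ x_n$. Involutive division. An involutive division $L$ on $\mathbb{M}$ is given if for every finite $U\subset\mathbb{M}$ and every $u\in U$ there is given a submonoid $L(u,U)$ of $\mathbb{M}$ such that: (a) if $w\in L(u,U)$ and $v\mid w$ then $v\in L(u,U)$; (b) if $u,v\in U$ and $uL(u,U)\cap vL(v,U)\ne\emptyset$ then $u\in vL(v,U)$ or $v\in uL(u,U)$; (c) if $v\in U$ and $v\in uL(u,U)$ then $L(v,U)\subseteq L(u,U)$; (d) if $V\subseteq U$ then $L(u,U)\subseteq L(u,V)$ for all $u\in V$. Write $u\mid_L w$ ($u$ is an involutive divisor of $w$) if $w\in uL(u,U)$. The variables in $L(u,U)$ are the multiplicative ones, $M_L(u,U)$; the other variables form $NM_L(u,U)$ (non-multiplicative). Continuous: for every finite $U$ and finite sequence $u_1,\dots,u_k$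 in $U$ such that for each $i<k$ there is $x_j\in NM_L(u_i,U)$ with $u_{i+1}\mid_L u_i\cdot x_j$, one has $u_i\neq u_j$ for $i\neq j$. Constructive: $L$ is continuous and for every finite $U\subset\mathbb{M}$, $u\in U$, $x_i\in NM_L(u,U)$ such that $u\cdot x_i$ has no involutive divisor in $U$ and every product $v\cdot x_j$ with $v\in U$, $x_j\in NM_L(v,U)$, $v\cdot x_j\mid u\cdot x_i$, $v\cdot x_j\ne u\cdot x_i$ lies in $\bigcup_{t\in U}tL(t,U)$, one has $u\cdot x_i\notin wL(w,U\cup\{w\})$ for every $w\in\bigcup_{t\in U}tL(t,U)$. Monomial bases. A monomial set $U$ is $L$-autoreduced if $uL(u,U)\cap vL(v,U)=\emptyset$ for all distinct $u,v\in U$, and $L$-involutive if $\bigcup_{u\in U}u\mathbb{M}=\bigcup_{u\in U}uL(u,U)$. An $L$-involutive basis of a monomial ideal is an $L$-autoreduced $L$-involutive monomial set generating the ideal. It is minimal if it is contained in every other $L$-involutive basis of the same ideal. Polynomial bases. For a finite set $F$ of nonzero polynomials, $p$ is $L$-reducible modulo $F$ if $p$ contains a term $a\,u$ ($a\in K\setminus\{0\}$, $u\in\mathbb{M}$) with $u=lm(f)\,v$, $f\in F$, $v\in L(lm(f),lm(F))$; the reduction step is $p\to p-(a/lc(f))\,f\,v$. $NF_L(p,F)$ denotes the $L$-normal form, i.e. the $L$-irreducible polynomial obtained from $p$ by such reductions (unique if $F$ is $L$-autoreduced). $F$ is $L$-autoreduced if its elements have pairwise distinct leading monomials, $lm(F)$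 is $L$-autoreduced, and no $f\in F$ contains, apart from $lm(f)$ itself, a monomial which is an involutive multiple of an element of $lm(F)$. An $L$-autoreduced set $F$ is $L$-involutive (an $L$-involutive basis of $Id(F)$) if $NF_L(fu,F)=0$ for all $f\in F$, $u\in\mathbb{M}$. A finite $L$-involutive basis $G$ is minimal if $lm(G)$ is the minimal $L$-involutive basis of the monomial ideal generated by $\{lm(f)\mid f\in Id(G)\setminus\{0\}\}$. *)

theory Defs
  imports Complex_Main "HOL-Library.Poly_Mapping"
begin

text \<open>
  Monomials in the variables indexed by the finite linearly ordered type \<open>'n\<close>
  are exponent vectors, so the product of monomials is \<open>+\<close> and the monomial 1 is \<open>0\<close>.
  On polynomials \<open>*\<close> is convolution, i.e. the usual product.
\<close>

type_synonym 'n mon = "'n \<Rightarrow>\<^sub>0 nat"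
type_synonym ('n, 'k) mpoly = "'n mon \<Rightarrow>\<^sub>0 'k"

definition var :: "'n \<Rightarrow> 'n mon" where
  "var i = Poly_Mapping.single i 1"

definition mon_dvd :: "'n mon \<Rightarrow> 'n mon \<Rightarrow> bool" where
  "mon_dvd u v \<longleftrightarrow> (\<exists>w. v = u + w)"

definition monomial_poly :: "'n mon \<Rightarrow> ('n, 'k::comm_ring_1) mpoly" where
  "monomial_poly u = Poly_Mapping.single u 1"

text \<open>The ideal generated by a set is its span in the ring viewed as a module over itself.\<close>

definition ideal_gen :: "('n, 'k::comm_ring_1) mpoly set \<Rightarrow> ('n, 'k) mpoly set" where
  "ideal_gen F = module.span (*) F"

text \<open>\<open>gt u v\<close> stands for the strict relation \<open>u \<succ> v\<close>.\<close>

definition admissible :: "('n mon \<Rightarrow> 'n mon \<Rightarrow> bool) \<Rightarrow> bool" where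
  "admissible gt \<longleftrightarrow>
     irreflp gt \<and> transp gt \<and> totalp gt \<and>
     (\<forall>u. u \<noteq> 0 \<longrightarrow> gt u 0) \<and>
     (\<forall>u v w. gt u v \<longrightarrow> gt (u + w) (v + w))"

definition vars_decreasing :: "(('n::linorder) mon \<Rightarrow> 'n mon \<Rightarrow> bool) \<Rightarrow> bool" where
  "vars_decreasing gt \<longleftrightarrow> (\<forall>i j. i < j \<longrightarrow> gt (var i) (var j))"

text \<open>Only meaningful for nonzero polynomials.\<close>

definition lm :: "('n mon \<Rightarrow> 'n mon \<Rightarrow> bool) \<Rightarrow> ('n, 'k::zero) mpoly \<Rightarrow> 'n mon" where
  "lm gt f = (THE u. u \<in> Poly_Mapping.keys f \<and> (\<forall>v\<in>Poly_Mapping.keys f. v \<noteq> u \<longrightarrow> gt u v))"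

definition lc :: "('n mon \<Rightarrow> 'n mon \<Rightarrow> bool) \<Rightarrow> ('n, 'k::zero) mpoly \<Rightarrow> 'k" where
  "lc gt f = Poly_Mapping.lookup f (lm gt f)"

definition monic :: "('n mon \<Rightarrow> 'n mon \<Rightarrow> bool) \<Rightarrow> ('n, 'k::zero_neq_one) mpoly \<Rightarrow> bool" where
  "monic gt f \<longleftrightarrow> lc gt f = 1"

text \<open>
  A division is a function \<open>L\<close> with \<open>L u U\<close> the set \<open>L(u,U)\<close>; its values are only
  constrained, and only used, for finite \<open>U\<close> and \<open>u \<in> U\<close>.
\<close>

type_synonym 'n division = "'n mon \<Rightarrow> 'n mon set \<Rightarrow> 'n mon set"

definition submonoid :: "'n mon set \<Rightarrow> bool" where
  "submonoid S \<longleftrightarrow> 0 \<in> S \<and> (\<forall>u\<in>S. \<forall>v\<in>S. u + v \<in> S)"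

text \<open>\<open>cone L u U\<close> is \<open>u L(u,U)\<close>, and \<open>cones L U\<close> is the union of these over \<open>u \<in> U\<close>.\<close>

definition cone :: "'n division \<Rightarrow> 'n mon \<Rightarrow> 'n mon set \<Rightarrow> 'n mon set" where
  "cone L u U = {u + w |w. w \<in> L u U}"

definition cones :: "'n division \<Rightarrow> 'n mon set \<Rightarrow> 'n mon set" where
  "cones L U = (\<Union>u\<in>U. cone L u U)"

definition involutive_division :: "'n division \<Rightarrow> bool" where
  "involutive_division L \<longleftrightarrow>
     (\<forall>U. finite U \<longrightarrow>
        (\<forall>u\<in>U. submonoid (L u U)) \<and>
        (\<forall>u\<in>U. \<forall>w v. w \<in> L u U \<longrightarrow> mon_dvd v w \<longrightarrow> v \<in> L u U) \<and>
        (\<forall>u\<in>U. \<forall>v\<in>U. cone L u U \<inter> cone L v U \<noteq> {} \<longrightarrow> u \<in> cone L v U \<or> v \<in> cone L u U) \<and>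
        (\<forall>u\<in>U. \<forall>v\<in>U. v \<in> cone L u U \<longrightarrow> L v U \<subseteq> L u U) \<and>
        (\<forall>V. V \<subseteq> U \<longrightarrow> (\<forall>u\<in>V. L u U \<subseteq> L u V)))"

definition nonmult :: "'n division \<Rightarrow> 'n mon \<Rightarrow> 'n mon set \<Rightarrow> 'n set" where
  "nonmult L u U = {i. var i \<notin> L u U}"

definition continuous_division :: "'n division \<Rightarrow> bool" where
  "continuous_division L \<longleftrightarrow>
     (\<forall>U us. finite U \<longrightarrow> set us \<subseteq> U \<longrightarrow>
        (\<forall>i. Suc i < length us \<longrightarrow>
           (\<exists>j\<in>nonmult L (us ! i) U. us ! i + var j \<in> cone L (us ! Suc i) U)) \<longrightarrow>
        distinct us)"

definition constructive_division :: "'n division \<Rightarrow> bool" where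
  "constructive_division L \<longleftrightarrow>
     continuous_division L \<and>
     (\<forall>U. finite U \<longrightarrow> (\<forall>u\<in>U. \<forall>i\<in>nonmult L u U.
        u + var i \<notin> cones L U \<longrightarrow>
        (\<forall>v\<in>U. \<forall>j\<in>nonmult L v U.
           mon_dvd (v + var j) (u + var i) \<longrightarrow> v + var j \<noteq> u + var i \<longrightarrow> v + var j \<in> cones L U) \<longrightarrow>
        (\<forall>w\<in>cones L U. u + var i \<notin> cone L w (U \<union> {w}))))"

definition mon_autoreduced :: "'n division \<Rightarrow> 'n mon set \<Rightarrow> bool" where
  "mon_autoreduced L U \<longleftrightarrow> (\<forall>u\<in>U. \<forall>v\<in>U. u \<noteq> v \<longrightarrow> cone L u U \<inter> cone L v U = {})"

definition mon_involutive :: "'n division \<Rightarrow> 'n mon set \<Rightarrow> bool" where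
  "mon_involutive L U \<longleftrightarrow> (\<Union>u\<in>U. {u + w |w. True}) = cones L U"

definition mon_involutive_basis ::
    "'n division \<Rightarrow> 'n mon set \<Rightarrow> ('n, 'k::comm_ring_1) mpoly set \<Rightarrow> bool" where
  "mon_involutive_basis L U I \<longleftrightarrow>
     finite U \<and> mon_autoreduced L U \<and> mon_involutive L U \<and> ideal_gen (monomial_poly ` U) = I"

definition minimal_mon_involutive_basis ::
    "'n division \<Rightarrow> 'n mon set \<Rightarrow> ('n, 'k::comm_ring_1) mpoly set \<Rightarrow> bool" where
  "minimal_mon_involutive_basis L U I \<longleftrightarrow>
     mon_involutive_basis L U I \<and> (\<forall>V. mon_involutive_basis L V I \<longrightarrow> U \<subseteq> V)"

definition reducible ::
    "('n mon \<Rightarrow> 'n mon \<Rightarrow> bool) \<Rightarrow> 'n division \<Rightarrow> ('n, 'k::field) mpoly set \<Rightarrow>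
     ('n, 'k) mpoly \<Rightarrow> bool" where
  "reducible gt L F p \<longleftrightarrow>
     (\<exists>u\<in>Poly_Mapping.keys p. \<exists>f\<in>F. \<exists>v\<in>L (lm gt f) (lm gt ` F). u = lm gt f + v)"

definition red_step ::
    "('n mon \<Rightarrow> 'n mon \<Rightarrow> bool) \<Rightarrow> 'n division \<Rightarrow> ('n, 'k::field) mpoly set \<Rightarrow>
     ('n, 'k) mpoly \<Rightarrow> ('n, 'k) mpoly \<Rightarrow> bool" where
  "red_step gt L F p q \<longleftrightarrow>
     (\<exists>u\<in>Poly_Mapping.keys p. \<exists>f\<in>F. \<exists>v\<in>L (lm gt f) (lm gt ` F). u = lm gt f + v \<and>
        q = p - Poly_Mapping.single v (Poly_Mapping.lookup p u / lc gt f) * f)"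

text \<open>
  The description is proper when \<open>F\<close> is autoreduced (see \<open>autoreduced\<close> below),
  the only case in which it is used.
\<close>

definition NF ::
    "('n mon \<Rightarrow> 'n mon \<Rightarrow> bool) \<Rightarrow> 'n division \<Rightarrow> ('n, 'k::field) mpoly set \<Rightarrow>
     ('n, 'k) mpoly \<Rightarrow> ('n, 'k) mpoly" where
  "NF gt L F p = (THE q. (red_step gt L F)\<^sup>*\<^sup>* p q \<and> \<not> reducible gt L F q)"

definition autoreduced ::
    "('n mon \<Rightarrow> 'n mon \<Rightarrow> bool) \<Rightarrow> 'n division \<Rightarrow> ('n, 'k::field) mpoly set \<Rightarrow> bool" where
  "autoreduced gt L F \<longleftrightarrow>
     finite F \<and> 0 \<notin> F \<and> inj_on (lm gt) F \<and> mon_autoreduced L (lm gt ` F) \<and>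
     (\<forall>f\<in>F. \<forall>u\<in>Poly_Mapping.keys f. u \<noteq> lm gt f \<longrightarrow> u \<notin> cones L (lm gt ` F))"

definition involutive_basis ::
    "('n mon \<Rightarrow> 'n mon \<Rightarrow> bool) \<Rightarrow> 'n division \<Rightarrow> ('n, 'k::field) mpoly set \<Rightarrow> bool" where
  "involutive_basis gt L F \<longleftrightarrow>
     autoreduced gt L F \<and> (\<forall>f\<in>F. \<forall>u. NF gt L F (f * monomial_poly u) = 0)"

definition minimal_involutive_basis ::
    "('n mon \<Rightarrow> 'n mon \<Rightarrow> bool) \<Rightarrow> 'n division \<Rightarrow> ('n, 'k::field) mpoly set \<Rightarrow> bool" where
  "minimal_involutive_basis gt L G \<longleftrightarrow>
     finite G \<and> involutive_basis gt L G \<and>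
     minimal_mon_involutive_basis L (lm gt ` G)
       (ideal_gen (monomial_poly ` lm gt ` (ideal_gen G - {0})) :: ('n, 'k) mpoly set)"

end

theory Submission
  imports Defs
begin

text \<open>
  Minimality pins down the leading monomials: the monomial ideal of leading monomials depends
  only on the polynomial ideal, and two minimal involutive bases of it contain each other
  (\<open>minimal_mon_involutive_basis_unique\<close>). So the elements of the two bases are paired by their
  leading monomials, forming one set \<open>U\<close>, and it remains to see that paired elements \<open>f\<close>, \<open>g\<close>
  are equal.

  Both are monic, so the common leading monomial cancels in \<open>f - g\<close>, and every monomial of
  \<open>f - g\<close> is a non-leading monomial of \<open>f\<close> or of \<open>g\<close>. By autoreducedness none of these has
  an involutive divisor in \<open>U\<close>. But \<open>f - g\<close> lies in the ideal; were it nonzero, its leading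
  monomial would lie in the ideal generated by \<open>U\<close>, hence be an ordinary multiple of an element of
  \<open>U\<close> (\<open>monomial_in_monomial_ideal\<close>), hence an involutive multiple of one, \<open>U\<close> being involutive
  (\<open>lm_in_cones\<close>). This contradiction gives \<open>f = g\<close>.
\<close>

lemma module_mpoly: "module ((*) :: ('n, 'k::comm_ring_1) mpoly \<Rightarrow> _)"
  by unfold_locales (simp_all add: algebra_simps)

lemma ideal_gen_superset: "F \<subseteq> ideal_gen F"
  unfolding ideal_gen_def by (rule module.span_superset[OF module_mpoly])

lemma ideal_gen_diff: "p \<in> ideal_gen F \<Longrightarrow> q \<in> ideal_gen F \<Longrightarrow> p - q \<in> ideal_gen F"
  unfolding ideal_gen_def by (rule module.span_diff[OF module_mpoly])

text \<open>
  The polynomials all of whose monomials are multiples of elements of \<open>U\<close> form an ideal,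
  which contains the generators.
\<close>

lemma monomial_in_monomial_ideal:
  assumes "(monomial_poly w :: ('n, 'k::comm_ring_1) mpoly) \<in> ideal_gen (monomial_poly ` U)"
  shows "w \<in> (\<Union>u\<in>U. {u + v |v. True})"
proof -
  define M where "M = (\<Union>u\<in>U. {u + v |v. True})"
  define J where "J = {p :: ('n, 'k) mpoly. Poly_Mapping.keys p \<subseteq> M}"
  interpret m: module "(*) :: ('n, 'k) mpoly \<Rightarrow> _" by (rule module_mpoly)
  have M_add: "x + y \<in> M" if y: "y \<in> M" for x y
  proof -
    from y obtain u v where "u \<in> U" "y = u + v" unfolding M_def by blast
    moreover from this have "x + y = u + (x + v)" by (simp add: algebra_simps)
    ultimately show ?thesis unfolding M_def by blast
  qed
  have "m.subspace J"
  proof (rule m.subspaceI)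
    show "0 \<in> J" by (simp add: J_def)
    show "p + q \<in> J" if "p \<in> J" "q \<in> J" for p q
      using that Poly_Mapping.keys_add[of p q] by (auto simp: J_def)
    show "c * p \<in> J" if p: "p \<in> J" for c p
    proof -
      have "{x + y |x y. x \<in> Poly_Mapping.keys c \<and> y \<in> Poly_Mapping.keys p} \<subseteq> M"
        using p M_add by (auto simp: J_def)
      with keys_mult[of c p] show ?thesis unfolding J_def by simp
    qed
  qed
  moreover have "monomial_poly ` U \<subseteq> J"
  proof -
    have "u \<in> M" if "u \<in> U" for u
      unfolding M_def using that by (metis (mono_tags, lifting) UN_iff add.right_neutral mem_Collect_eq)
    then show ?thesis by (auto simp: monomial_poly_def J_def)
  qed
  ultimately have "ideal_gen (monomial_poly ` U) \<subseteq> J"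
    unfolding ideal_gen_def by (intro m.span_minimal)
  with assms have "w \<in> M" by (auto simp: monomial_poly_def J_def)
  then show ?thesis unfolding M_def .
qed

lemma lm_in_keys:
  assumes gt: "admissible gt" and "p \<noteq> 0"
  shows "lm gt p \<in> Poly_Mapping.keys p"
proof -
  let ?K = "Poly_Mapping.keys p"
  from gt have irr: "irreflp gt" and tr: "transp gt" and tot: "totalp gt"
    by (auto simp: admissible_def)
  \<comment> \<open>\<open>gt\<close> is a reversed order, so its least element is the largest monomial.\<close>
  have "\<exists>u\<in>?K. \<forall>v\<in>?K. v \<noteq> u \<longrightarrow> gt u v"
    using assms(2) tr tot
    by (intro Finite_Set.bex_least_element) (auto intro: transp_on_subset totalp_on_subset)
  then obtain u where u: "u \<in> ?K \<and> (\<forall>v\<in>?K. v \<noteq> u \<longrightarrow> gt u v)"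
    by blast
  have "lm gt p = u"
    unfolding lm_def
  proof (rule the_equality[where P = "\<lambda>u. u \<in> ?K \<and> (\<forall>v\<in>?K. v \<noteq> u \<longrightarrow> gt u v)", OF u])
    fix v assume v: "v \<in> ?K \<and> (\<forall>w\<in>?K. w \<noteq> v \<longrightarrow> gt v w)"
    show "v = u"
    proof (rule ccontr)
      assume "v \<noteq> u"
      with u v have "gt u v" "gt v u" by auto
      then have "gt u u" by (rule transpD[OF tr])
      with irr show False by (simp add: irreflp_def)
    qed
  qed
  with u show ?thesis by simp
qed

lemma minimal_mon_involutive_basis_unique:
  "minimal_mon_involutive_basis L U I \<Longrightarrow> minimal_mon_involutive_basis L V I \<Longrightarrow> U = V"
  unfolding minimal_mon_involutive_basis_def by blast

text \<open>
  A minimal involutive basis behaves like a Groebner basis here: the leading monomials of \<open>G\<close> generate the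
  monomial ideal of all leading monomials of the ideal. Involutivity of
  this monomial set then upgrades ordinary divisibility to involutive divisibility.
\<close>

lemma lm_in_cones:
  fixes p :: "('n, 'k::field) mpoly"
  assumes "minimal_involutive_basis gt L G" and "p \<in> ideal_gen G" and "p \<noteq> 0"
  shows "lm gt p \<in> cones L (lm gt ` G)"
proof -
  let ?J = "ideal_gen (monomial_poly ` lm gt ` (ideal_gen G - {0})) :: ('n, 'k) mpoly set"
  have inv: "mon_involutive L (lm gt ` G)" and J: "ideal_gen (monomial_poly ` lm gt ` G) = ?J"
    using assms(1)
    by (auto simp: minimal_involutive_basis_def minimal_mon_involutive_basis_def
        mon_involutive_basis_def)
  have "monomial_poly (lm gt p) \<in> ?J"
    using assms(2,3) by (intro subsetD[OF ideal_gen_superset]) blast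
  then have "lm gt p \<in> (\<Union>u\<in>lm gt ` G. {u + v |v. True})"
    unfolding J[symmetric] by (rule monomial_in_monomial_ideal)
  then show ?thesis using inv unfolding mon_involutive_def by (simp only:)
qed

lemma nonleading_notin_cones:
  "minimal_involutive_basis gt L G \<Longrightarrow> f \<in> G \<Longrightarrow> u \<in> Poly_Mapping.keys f \<Longrightarrow> u \<noteq> lm gt f
    \<Longrightarrow> u \<notin> cones L (lm gt ` G)"
  by (auto simp: minimal_involutive_basis_def involutive_basis_def autoreduced_def)

text \<open>
  One inclusion suffices, the hypotheses being symmetric in the two bases. The difference of
  paired elements is an irreducible member of the ideal, hence zero.
\<close>

lemma monic_minimal_involutive_basis_subset:
  fixes G H :: "('n, 'k::field) mpoly set"
  assumes gt: "admissible gt"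
    and G: "minimal_involutive_basis gt L G" "\<forall>g\<in>G. monic gt g"
    and H: "minimal_involutive_basis gt L H" "\<forall>g\<in>H. monic gt g"
    and GH: "ideal_gen G = ideal_gen H"
  shows "G \<subseteq> H"
proof
  fix f assume f: "f \<in> G"
  let ?I = "ideal_gen (monomial_poly ` lm gt ` (ideal_gen H - {0})) :: ('n, 'k) mpoly set"
  have "minimal_mon_involutive_basis L (lm gt ` G) ?I" "minimal_mon_involutive_basis L (lm gt ` H) ?I"
    using G(1) H(1) GH by (simp_all add: minimal_involutive_basis_def)
  then have U: "lm gt ` G = lm gt ` H" by (rule minimal_mon_involutive_basis_unique)
  with f obtain g where g: "g \<in> H" "lm gt g = lm gt f" by (metis imageE imageI)
  have "f - g = 0"
  proof (rule ccontr)
    assume nz: "f - g \<noteq> 0"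
    let ?u = "lm gt (f - g)"
    have "f - g \<in> ideal_gen G"
    proof (rule ideal_gen_diff)
      show "f \<in> ideal_gen G" using f by (rule subsetD[OF ideal_gen_superset])
      show "g \<in> ideal_gen G" unfolding GH using g(1) by (rule subsetD[OF ideal_gen_superset])
    qed
    then have cone: "?u \<in> cones L (lm gt ` G)"
      using lm_in_cones[OF G(1)] nz by blast
    have u: "?u \<in> Poly_Mapping.keys (f - g)" by (rule lm_in_keys[OF gt nz])
    have "Poly_Mapping.lookup (f - g) (lm gt f) = 0"
      using f g G(2) H(2) by (auto simp: monic_def lc_def lookup_minus)
    with u have "?u \<noteq> lm gt f" by (auto simp: in_keys_iff)
    moreover have "?u \<in> Poly_Mapping.keys f \<or> ?u \<in> Poly_Mapping.keys g"
      using u by (auto simp: in_keys_iff lookup_minus)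
    ultimately show False
      using cone nonleading_notin_cones[OF G(1) f] nonleading_notin_cones[OF H(1) g(1)] U g(2)
      by auto
  qed
  with g show "f \<in> H" by simp
qed

theorem theorem5p2:
  fixes gt :: "('n::{finite,linorder}) mon \<Rightarrow> 'n mon \<Rightarrow> bool"
    and L :: "'n division"
    and G\<^sub>1 G\<^sub>2 :: "('n, 'k::field_char_0) mpoly set"
  assumes "admissible gt"
    and "vars_decreasing gt"
    and "involutive_division L"
    and "constructive_division L"
    and "minimal_involutive_basis gt L G\<^sub>1"
    and "minimal_involutive_basis gt L G\<^sub>2"
    and "ideal_gen G\<^sub>1 = ideal_gen G\<^sub>2"
    and "\<forall>g\<in>G\<^sub>1. monic gt g"
    and "\<forall>g\<in>G\<^sub>2. monic gt g"
  shows "G\<^sub>1 = G\<^sub>2"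
proof (rule equalityI)
  show "G\<^sub>1 \<subseteq> G\<^sub>2"
    using monic_minimal_involutive_basis_subset[OF assms(1,5,8,6,9,7)] .
  show "G\<^sub>2 \<subseteq> G\<^sub>1"
    using monic_minimal_involutive_basis_subset[OF assms(1,6,9,5,8) assms(7)[symmetric]] .
qed

end
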